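(* Let $k,\rho,c,\lambda,\Theta_\infty>0$ be constants and set $\alpha=\frac{k}{\rho c}$, $\mathrm{Ste}=\frac{c\Theta_\infty}{\lambda}$. The solution of Problem (P3$_\infty$) for a quadratic profile in space is unique and is given by $$T_{3\infty}(x,t)=-A_{3\infty}\Theta_{\infty}\left(1-\frac{x}{s_{3\infty}(t)}\right)-B_{3\infty}\Theta_{\infty}\left(1-\frac{x}{s_{3\infty}(t)}\right)^{2},\qquad s_{3\infty}(t)=2\xi_{3\infty}\sqrt{\alpha t},$$ where the positive constants $A_{3\infty},B_{3\infty},\xi_{3\infty}$ are $$A_{3\infty}=\frac{6}{6+\mathrm{Ste}},\qquad B_{3\infty}=\frac{\mathrm{Ste}}{6+\mathrm{Ste}},\qquad \xi_{3\infty}=\sqrt{\frac{3\mathrm{Ste}}{6+\mathrm{Ste}}}.$$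
   Context: Problem (P3$_\infty$): find $s_{3\infty}=s_{3\infty}(t)$ and $T_{3\infty}=T_{3\infty}(x,t)$, defined for $0\le x\le s_{3\infty}(t)$, $t>0$, such that - $\displaystyle\int_0^{s_{3\infty}(t)}\int_0^x\frac{\partial T_{3\infty}}{\partial t}(\eta,t)\,d\eta\,dx=-\dfrac{k}{\rho c}\left[T_{3\infty}(0,t)+\dfrac{\partial T_{3\infty}}{\partial x}(0,t)\,s_{3\infty}(t)\right]$, $t>0$; - $T_{3\infty}(0,t)=-\Theta_{\infty}$, $t>0$; - $T_{3\infty}(s_{3\infty}(t),t)=0$, $t>0$; - $k\dfrac{\partial T_{3\infty}}{\partial x}(s_{3\infty}(t),t)=\rho\lambda\dot{s}_{3\infty}(t)$, $t>0$; - $s_{3\infty}(0)=0$. A solution "for a quadratic profile in space" is a solution pair in which $T_{3\infty}(x,t)=-A\Theta_\infty\left(1-\frac{x}{s_{3\infty}(t)}\right)-B\Theta_\infty\left(1-\frac{x}{s_{3\infty}(t)}\right)^2$ for some constants $A>0$, $B>0$, with $s_{3\infty}$ continuous on $[0,\infty)$, continuously differentiable and positive on $(0,\infty)$. *)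

theory Defs
  imports "HOL-Analysis.Analysis"
begin

text \<open>
  A pair \<open>(s, T)\<close> is represented by total functions; only the values \<open>s t\<close> for \<open>t \<ge> 0\<close> and
  \<open>T x t\<close> for \<open>t > 0\<close>, \<open>0 \<le> x \<le> s t\<close> are meaningful. Accordingly, the partial derivatives \<open>Tx\<close>
  and \<open>Tt\<close> are taken within the space-time domain, so they are one-sided at its boundary. For a
  continuous positive front \<open>s\<close> they are uniquely determined, except possibly \<open>Tt\<close> at the single
  point \<open>x = s t\<close> of each time slice, which does not affect the integral.
\<close>

definition solves_P3_inf ::
  "real \<Rightarrow> real \<Rightarrow> real \<Rightarrow> real \<Rightarrow> real \<Rightarrow> (real \<Rightarrow> real) \<Rightarrow> (real \<Rightarrow> real \<Rightarrow> real) \<Rightarrow> bool" where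
  "solves_P3_inf k \<rho> c lam \<Theta> s T \<longleftrightarrow>
     (\<exists>s' Tx Tt.
        (\<forall>t>0. (s has_real_derivative s' t) (at t)) \<and>
        (\<forall>t>0. \<forall>x\<in>{0..s t}.
           ((\<lambda>y. T y t) has_real_derivative Tx x t) (at x within {0..s t}) \<and>
           ((\<lambda>\<tau>. T x \<tau>) has_real_derivative Tt x t) (at t within {\<tau>. 0 < \<tau> \<and> x \<le> s \<tau>})) \<and>
        (\<forall>t>0. (\<lambda>\<eta>. Tt \<eta> t) integrable_on {0..s t}) \<and>
        (\<forall>t>0. ((\<lambda>x. integral {0..x} (\<lambda>\<eta>. Tt \<eta> t)) has_integral
                  (- (k / (\<rho> * c)) * (T 0 t + Tx 0 t * s t))) {0..s t}) \<and>
        (\<forall>t>0. T 0 t = - \<Theta>) \<and>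
        (\<forall>t>0. T (s t) t = 0) \<and>
        (\<forall>t>0. k * Tx (s t) t = \<rho> * lam * s' t) \<and>
        s 0 = 0)"

definition quadratic_profile ::
  "real \<Rightarrow> real \<Rightarrow> real \<Rightarrow> (real \<Rightarrow> real) \<Rightarrow> real \<Rightarrow> real \<Rightarrow> real" where
  "quadratic_profile \<Theta> A B s x t = - A * \<Theta> * (1 - x / s t) - B * \<Theta> * (1 - x / s t)\<^sup>2"

definition quadratic_solution_P3_inf ::
  "real \<Rightarrow> real \<Rightarrow> real \<Rightarrow> real \<Rightarrow> real \<Rightarrow> (real \<Rightarrow> real) \<Rightarrow> (real \<Rightarrow> real \<Rightarrow> real) \<Rightarrow> bool" where
  "quadratic_solution_P3_inf k \<rho> c lam \<Theta> s T \<longleftrightarrow>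
     continuous_on {0..} s \<and> s C1_differentiable_on {0<..} \<and> (\<forall>t>0. 0 < s t) \<and>
     (\<exists>A>0. \<exists>B>0. \<forall>t>0. \<forall>x\<in>{0..s t}. T x t = quadratic_profile \<Theta> A B s x t) \<and>
     solves_P3_inf k \<rho> c lam \<Theta> s T"

end

theory Submission
  imports Defs
begin

text \<open>
  For a quadratic profile the boundary condition at \<open>x = 0\<close> says \<open>A + B = 1\<close>, the one at \<open>x = s t\<close>
  is automatic, and the Stefan condition and the heat balance say that \<open>s s'\<close> is the constant
  \<open>\<alpha> Ste A\<close> and the constant \<open>6 \<alpha> B\<close>, respectively. Equality of these constants fixes \<open>A\<close> and \<open>B\<close>,
  and \<open>(s\<^sup>2)' = 12 \<alpha> B\<close> with \<open>s 0 = 0\<close> fixes \<open>s\<close>.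
\<close>

section \<open>Derivatives and integrals of the profile\<close>

definition profile_dx :: "real \<Rightarrow> real \<Rightarrow> real \<Rightarrow> real \<Rightarrow> real \<Rightarrow> real" where
  "profile_dx \<Theta> A B l x = A * \<Theta> / l + 2 * B * \<Theta> * (1 - x / l) / l"

text \<open>The front enters only through its position \<open>l\<close> and speed \<open>d\<close>
  at a fixed time, so that each time slice is a plain polynomial in \<open>x\<close> when it is
  integrated.\<close>

definition profile_dt :: "real \<Rightarrow> real \<Rightarrow> real \<Rightarrow> real \<Rightarrow> real \<Rightarrow> real \<Rightarrow> real" where
  "profile_dt \<Theta> A B l d x =
     - (A * \<Theta> * (x * d / l\<^sup>2)) - 2 * B * \<Theta> * (1 - x / l) * (x * d / l\<^sup>2)"

lemma quadratic_profile_deriv_x: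
  assumes "s t \<noteq> 0"
  shows "((\<lambda>y. quadratic_profile \<Theta> A B s y t) has_real_derivative profile_dx \<Theta> A B (s t) x)
           (at x within S)"
  unfolding quadratic_profile_def profile_dx_def
  using assms by (auto intro!: derivative_eq_intros simp: field_simps power2_eq_square)

lemma quadratic_profile_deriv_t:
  assumes "(s has_real_derivative d) (at t within S)" and "s t \<noteq> 0"
  shows "((\<lambda>\<tau>. quadratic_profile \<Theta> A B s x \<tau>) has_real_derivative profile_dt \<Theta> A B (s t) d x)
           (at t within S)"
  unfolding quadratic_profile_def profile_dt_def
  by (rule derivative_eq_intros refl assms | simp add: assms field_simps power2_eq_square)+

lemma profile_dt_has_integral:
  fixes l x :: real
  assumes "l \<noteq> 0" and "0 \<le> x"
  shows "(profile_dt \<Theta> A B l d has_integral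
           - (A * \<Theta> * d / l\<^sup>2 * (x\<^sup>2 / 2)) - 2 * B * \<Theta> * d / l\<^sup>2 * (x\<^sup>2 / 2 - x ^ 3 / (3 * l))) {0..x}"
proof -
  let ?F = "\<lambda>x. - (A * \<Theta> * d / l\<^sup>2 * (x\<^sup>2 / 2))
                 - 2 * B * \<Theta> * d / l\<^sup>2 * (x\<^sup>2 / 2 - x ^ 3 / (3 * l))"
  have "(?F has_vector_derivative profile_dt \<Theta> A B l d y) (at y within {0..x})" for y
    unfolding profile_dt_def has_real_derivative_iff_has_vector_derivative[symmetric]
    by (rule derivative_eq_intros refl | simp add: assms field_simps power2_eq_square)+
  from fundamental_theorem_of_calculus[OF assms(2) this] show ?thesis by simp
qed

text \<open>The linear and the quadratic term of the profile both contribute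
  \<open>l * d / 6\<close>: for the latter, the factor 2 meets 1/6 - 1/12 = 1/12. Hence the result
  involves only \<open>A + B\<close>, which the condition at \<open>x = 0\<close> fixes.\<close>

lemma profile_dt_has_double_integral:
  fixes l :: real
  assumes "l > 0"
  shows "((\<lambda>x. integral {0..x} (profile_dt \<Theta> A B l d)) has_integral - ((A + B) * \<Theta> * l * d / 6)) {0..l}"
proof -
  let ?f = "\<lambda>x. - (A * \<Theta> * d / l\<^sup>2 * (x\<^sup>2 / 2))
                 - 2 * B * \<Theta> * d / l\<^sup>2 * (x\<^sup>2 / 2 - x ^ 3 / (3 * l))"
  let ?F = "\<lambda>x. - (A * \<Theta> * d / l\<^sup>2 * (x ^ 3 / 6))
                 - 2 * B * \<Theta> * d / l\<^sup>2 * (x ^ 3 / 6 - x ^ 4 / (12 * l))"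
  have "(?F has_vector_derivative ?f y) (at y within {0..l})" for y
    unfolding has_real_derivative_iff_has_vector_derivative[symmetric]
    using assms by (auto intro!: derivative_eq_intros simp: divide_simps)
  from fundamental_theorem_of_calculus[OF _ this] assms
  have "(?f has_integral ?F l - ?F 0) {0..l}" by simp
  also have "?F l - ?F 0 = - ((A + B) * \<Theta> * l * d / 6)"
    using assms by (simp add: field_simps eval_nat_numeral)
  finally show ?thesis
    by (rule has_integral_eq[rotated])
       (use assms in \<open>simp add: integral_unique[OF profile_dt_has_integral]\<close>)
qed

section \<open>Reduction to conditions on the coefficients and the front\<close>

lemma has_real_derivative_unique_at_within_Icc:
  fixes f :: "real \<Rightarrow> real"
  assumes "(f has_real_derivative d) (at x within {a..b})"
    and "(f has_real_derivative e) (at x within {a..b})"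
    and "a < b" and "x \<in> {a..b}"
  shows "d = e"
  using vector_derivative_unique_within_closed_interval[of a b x f d e] assms
  by (simp add: has_real_derivative_iff_has_vector_derivative)

text \<open>Existence uses this from right to left, uniqueness from left to right. \<open>T\<close>
  is tied to the profile only on the space-time domain, since its values elsewhere are
  arbitrary.\<close>

lemma quadratic_profile_solves_iff:
  assumes pos: "\<forall>t>0. 0 < s t"
    and deriv: "\<forall>t>0. (s has_real_derivative s' t) (at t)"
    and profile: "\<forall>t>0. \<forall>x\<in>{0..s t}. T x t = quadratic_profile \<Theta> A B s x t"
    and \<Theta>: "\<Theta> \<noteq> 0"
  shows "solves_P3_inf k \<rho> c lam \<Theta> s T \<longleftrightarrow>
    A + B = 1 \<and> s 0 = 0 \<and>
    (\<forall>t>0. s t * s' t = 6 * (k / (\<rho> * c)) * B \<and> k * A * \<Theta> = \<rho> * lam * (s t * s' t))"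
    (is "_ \<longleftrightarrow> ?R")
proof -
  have Tx: "((\<lambda>y. T y t) has_real_derivative profile_dx \<Theta> A B (s t) x) (at x within {0..s t})"
    if "t > 0" "x \<in> {0..s t}" for t x
  proof -
    have "((\<lambda>y. quadratic_profile \<Theta> A B s y t) has_real_derivative profile_dx \<Theta> A B (s t) x)
            (at x within {0..s t})"
      using pos that by (intro quadratic_profile_deriv_x) force
    then show ?thesis
      using has_field_derivative_transform_within[of _ _ x "{0..s t}" 1 "\<lambda>y. T y t"] profile that
      by simp
  qed
  have Tt: "((\<lambda>\<tau>. T x \<tau>) has_real_derivative profile_dt \<Theta> A B (s t) (s' t) x)
              (at t within {\<tau>. 0 < \<tau> \<and> x \<le> s \<tau>})"
    if "t > 0" "x \<in> {0..s t}" for t x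
  proof -
    have "((\<lambda>\<tau>. quadratic_profile \<Theta> A B s x \<tau>) has_real_derivative
            profile_dt \<Theta> A B (s t) (s' t) x) (at t within {\<tau>. 0 < \<tau> \<and> x \<le> s \<tau>})"
      using pos deriv that
      by (intro quadratic_profile_deriv_t) (auto intro: has_field_derivative_at_within)
    then show ?thesis
      \<comment> \<open>The set of times is exactly where the fixed \<open>x\<close> lies in the
        domain, so \<open>T\<close> and the profile agree on all of it and any radius
        serves.\<close>
      using has_field_derivative_transform_within[of _ _ t "{\<tau>. 0 < \<tau> \<and> x \<le> s \<tau>}" 1 "\<lambda>\<tau>. T x \<tau>"]
        profile that
      by simp
  qed
  have T0: "T 0 t = - ((A + B) * \<Theta>)" and Ts: "T (s t) t = 0" if "t > 0" for t
    using profile[rule_format, of t 0] profile[rule_format, of t "s t"] pos[rule_format, OF that] that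
    by (simp_all add: quadratic_profile_def algebra_simps)
  have dx0: "profile_dx \<Theta> A B (s t) 0 * s t = (A + 2 * B) * \<Theta>"
    and dxs: "profile_dx \<Theta> A B (s t) (s t) = A * \<Theta> / s t" if "t > 0" for t
    using pos that by (force simp: profile_dx_def field_simps)+
  show ?thesis
  proof
    assume "solves_P3_inf k \<rho> c lam \<Theta> s T"
    then obtain s'' Ux Ut where
      s''_all: "\<forall>t>0. (s has_real_derivative s'' t) (at t)"
      and U_all: "\<forall>t>0. \<forall>x\<in>{0..s t}.
           ((\<lambda>y. T y t) has_real_derivative Ux x t) (at x within {0..s t}) \<and>
           ((\<lambda>\<tau>. T x \<tau>) has_real_derivative Ut x t) (at t within {\<tau>. 0 < \<tau> \<and> x \<le> s \<tau>})"
      and heat_all: "\<forall>t>0. ((\<lambda>x. integral {0..x} (\<lambda>\<eta>. Ut \<eta> t)) has_integral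
           (- (k / (\<rho> * c)) * (T 0 t + Ux 0 t * s t))) {0..s t}"
      and left_all: "\<forall>t>0. T 0 t = - \<Theta>"
      and Stefan_all: "\<forall>t>0. k * Ux (s t) t = \<rho> * lam * s'' t"
      and s0: "s 0 = 0"
      unfolding solves_P3_inf_def by (elim exE conjE) (rule that)
    note s'' = s''_all[rule_format] and heat = heat_all[rule_format]
      and left = left_all[rule_format] and Stefan = Stefan_all[rule_format]
      and Ux = U_all[rule_format, THEN conjunct1] and Ut = U_all[rule_format, THEN conjunct2]
    have AB: "A + B = 1"
      using T0[of 1] left[of 1] \<Theta> by simp
    have "s t * s' t = 6 * (k / (\<rho> * c)) * B \<and> k * A * \<Theta> = \<rho> * lam * (s t * s' t)"
      if t: "t > 0" for t
    proof -
      have st: "0 < s t" using pos t by blast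
      have s't: "s'' t = s' t"
        using DERIV_unique s'' deriv t by blast
      \<comment> \<open>The derivative is one-sided at both ends, but limits within a nondegenerate
        interval are still unique.\<close>
      have Ux_eq: "Ux x t = profile_dx \<Theta> A B (s t) x" if "x \<in> {0..s t}" for x
        using has_real_derivative_unique_at_within_Icc[OF Ux[OF t that] Tx[OF t that] st that] .
      \<comment> \<open>At \<open>x = s t\<close> the point \<open>t\<close> may be isolated in the time domain, so \<open>Ut\<close> is arbitrary there.\<close>
      have Ut_eq: "Ut x t = profile_dt \<Theta> A B (s t) (s' t) x" if x: "x \<in> {0..s t} - {s t}" for x
      proof -
        \<comment> \<open>For \<open>x < s t\<close>, continuity of \<open>s\<close> makes
          \<open>t\<close> an interior point of the time domain, so both derivatives there are
          ordinary ones.\<close>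
        have "isCont s t" using s''[OF t] by (rule DERIV_isCont)
        then have "\<forall>\<^sub>F \<tau> in at t. x < s \<tau>"
          using x by (intro order_tendstoD(1)[of s "s t"]) (auto simp: isCont_def)
        then have "\<forall>\<^sub>F \<tau> in nhds t. x < s \<tau>"
          using x by (auto simp: eventually_nhds_conv_at)
        moreover have "\<forall>\<^sub>F \<tau> in nhds t. 0 < \<tau>"
          using t by (intro eventually_nhds_in_open[of "{0<..}", simplified]) auto
        ultimately have "\<forall>\<^sub>F \<tau> in nhds t. \<tau> \<in> {\<tau>. 0 < \<tau> \<and> x \<le> s \<tau>}"
          by eventually_elim auto
        then have "at t within {\<tau>. 0 < \<tau> \<and> x \<le> s \<tau>} = at t"
          by (intro at_within_interior) (auto simp: eventually_nhds interior_def)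
        then show ?thesis
          using Ut[OF t, of x] Tt[OF t, of x] x by (auto intro: DERIV_unique)
      qed
      have "integral {0..x} (\<lambda>\<eta>. Ut \<eta> t) = integral {0..x} (profile_dt \<Theta> A B (s t) (s' t))"
        if "x \<in> {0..s t}" for x
        \<comment> \<open>The single point \<open>s t\<close>, where \<open>Ut\<close> is not
          determined, is negligible.\<close>
        using that by (intro integral_spike[of "{s t}"]) (auto simp: Ut_eq)
      then have "((\<lambda>x. integral {0..x} (\<lambda>\<eta>. Ut \<eta> t)) has_integral
            - ((A + B) * \<Theta> * s t * s' t / 6)) {0..s t}"
        using has_integral_eq[OF _ profile_dt_has_double_integral[OF st]] by simp
      then have "- (k / (\<rho> * c)) * (T 0 t + Ux 0 t * s t) = - ((A + B) * \<Theta> * s t * s' t / 6)"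
        using heat[OF t] has_integral_unique by blast
      \<comment> \<open>The terms in \<open>A\<close> cancel: -(A + B) + (A + 2 B) = B.\<close>
      also have "T 0 t + Ux 0 t * s t = B * \<Theta>"
        using T0[OF t] dx0[OF t] Ux_eq[of 0] st by (simp add: algebra_simps)
      finally have "\<Theta> * (s t * s' t) = \<Theta> * (6 * (k / (\<rho> * c)) * B)"
        using AB by (simp add: algebra_simps)
      then have "s t * s' t = 6 * (k / (\<rho> * c)) * B"
        using \<Theta> mult_left_cancel by blast
      moreover have "k * A * \<Theta> = \<rho> * lam * (s t * s' t)"
        using Stefan[OF t] s't Ux_eq[of "s t"] dxs[OF t] st by (simp add: field_simps)
      ultimately show ?thesis by blast
    qed
    then show ?R using AB s0 by blast
  next
    assume R: ?R
    have "profile_dt \<Theta> A B (s t) (s' t) integrable_on {0..s t}" if "t > 0" for t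
      using pos that
      by (intro has_integral_integrable[OF profile_dt_has_integral]) (auto simp: less_le)
    moreover have "((\<lambda>x. integral {0..x} (profile_dt \<Theta> A B (s t) (s' t))) has_integral
        - (k / (\<rho> * c)) * (T 0 t + profile_dx \<Theta> A B (s t) 0 * s t)) {0..s t}" if t: "t > 0" for t
    proof -
      have "- ((A + B) * \<Theta> * s t * s' t / 6) = - (\<Theta> * (s t * s' t) / 6)"
        using R by simp
      also have "\<dots> = - (k / (\<rho> * c)) * (B * \<Theta>)"
        using R t by simp
      also have "B * \<Theta> = T 0 t + profile_dx \<Theta> A B (s t) 0 * s t"
        using T0[OF t] dx0[OF t] by (simp add: algebra_simps)
      finally show ?thesis
        using profile_dt_has_double_integral[of "s t" \<Theta> A B "s' t"] pos t by simp
    qed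
    moreover have "k * profile_dx \<Theta> A B (s t) (s t) = \<rho> * lam * s' t" if "t > 0" for t
    proof -
      have "k * A * \<Theta> = \<rho> * lam * (s t * s' t)" and "s t \<noteq> 0"
        using R pos that by (auto simp: less_le)
      then show ?thesis by (simp add: dxs[OF that] field_simps)
    qed
    ultimately show "solves_P3_inf k \<rho> c lam \<Theta> s T"
      unfolding solves_P3_inf_def using deriv Tx Tt T0 Ts R
      by (intro exI[of _ s'] exI[of _ "\<lambda>x t. profile_dx \<Theta> A B (s t) x"]
          exI[of _ "\<lambda>x t. profile_dt \<Theta> A B (s t) (s' t) x"] conjI allI impI ballI) simp_all
  qed
qed

section \<open>The law of the front\<close>

lemma square_front_linear:
  fixes s :: "real \<Rightarrow> real"
  assumes "continuous_on {0..} s" and "s 0 = 0"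
    and "\<And>t. t > 0 \<Longrightarrow> (s has_real_derivative s' t) (at t)"
    and "\<And>t. t > 0 \<Longrightarrow> s t * s' t = m"
    and "t \<ge> 0"
  shows "(s t)\<^sup>2 = 2 * m * t"
proof (cases "t = 0")
  case False
  have "(\<lambda>t. (s t)\<^sup>2 - 2 * m * t) t = (\<lambda>t. (s t)\<^sup>2 - 2 * m * t) 0"
  \<comment> \<open>The derivative is required only inside the interval, and continuity carries the
    constant to 0, where a square-root front has no finite speed.\<close>
  proof (rule DERIV_isconst2[of 0 t])
    show "continuous_on {0..t} (\<lambda>t. (s t)\<^sup>2 - 2 * m * t)"
      by (intro continuous_intros continuous_on_subset[OF assms(1)]) auto
    show "((\<lambda>t. (s t)\<^sup>2 - 2 * m * t) has_real_derivative 0) (at x)" if "0 < x" for x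
      using assms(4)[OF that]
      by (auto intro!: derivative_eq_intros assms(3) that)
  qed (use False assms(5) in auto)
  then show ?thesis using assms(2) by simp
qed (use assms in simp)

section \<open>Existence and uniqueness\<close>

theorem theorem4p5:
  fixes k \<rho> c lam \<Theta> \<alpha> Ste A B \<xi> :: real and s3 :: "real \<Rightarrow> real"
  assumes "k > 0" and "\<rho> > 0" and "c > 0" and "lam > 0" and "\<Theta> > 0"
    and "\<alpha> = k / (\<rho> * c)" and "Ste = c * \<Theta> / lam"
    and "A = 6 / (6 + Ste)" and "B = Ste / (6 + Ste)" and "\<xi> = sqrt (3 * Ste / (6 + Ste))"
    and "s3 = (\<lambda>t. 2 * \<xi> * sqrt (\<alpha> * t))"
  shows "A > 0 \<and> B > 0 \<and> \<xi> > 0 \<and>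
    quadratic_solution_P3_inf k \<rho> c lam \<Theta> s3 (quadratic_profile \<Theta> A B s3) \<and>
    (\<forall>s T. quadratic_solution_P3_inf k \<rho> c lam \<Theta> s T \<longrightarrow>
       (\<forall>t\<ge>0. s t = s3 t) \<and>
       (\<forall>t>0. \<forall>x\<in>{0..s3 t}. T x t = quadratic_profile \<Theta> A B s3 x t))"
proof -
  have Ste: "Ste > 0" and \<alpha>: "\<alpha> > 0" using assms(1-7) by simp_all
  then have A: "A > 0" and B: "B > 0" and \<xi>: "\<xi> > 0" and SA: "Ste * A = 6 * B"
    using assms(8-10) by simp_all
  have AB: "A + B = 1"
    using assms(8,9) Ste by (simp flip: add_divide_distrib)
  \<comment> \<open>This turns the Stefan condition into
    \<open>s t * s' t = \<alpha> * Ste * A\<close>, to be compared with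
    \<open>6 * \<alpha> * B\<close> from the heat balance.\<close>
  have k\<Theta>: "k * \<Theta> = \<rho> * lam * (\<alpha> * Ste)"
    using assms(1-7) by simp
  have \<xi>2: "\<xi>\<^sup>2 = 3 * B" using assms(9,10) Ste by simp
  have s3_sqrt: "s3 t = sqrt (12 * \<alpha> * B * t)" for t
  proof -
    have "2 * \<xi> = sqrt (12 * B)"
      using \<xi> \<xi>2 by (intro real_sqrt_unique[symmetric]) (auto simp: power_mult_distrib)
    then show ?thesis using assms(11) by (simp add: mult_ac flip: real_sqrt_mult)
  qed
  \<comment> \<open>The speed is read off from \<open>s t * s' t = 6 * \<alpha> * B\<close>.\<close>
  let ?d = "\<lambda>t. 6 * \<alpha> * B / s3 t"
  have pos: "\<forall>t>0. 0 < s3 t" using \<alpha> B by (simp add: s3_sqrt)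
  have cont: "continuous_on S s3" for S
    unfolding assms(11) by (intro continuous_intros)
  have deriv: "(s3 has_real_derivative ?d t) (at t)" if "t > 0" for t
    \<comment> \<open>The square root is differentiable because its argument is positive.\<close>
    unfolding s3_sqrt using mult_pos_pos[OF B mult_pos_pos[OF \<alpha> that]]
    by (auto intro!: derivative_eq_intros simp: field_simps)
  have C1: "s3 C1_differentiable_on {0<..}"
    unfolding C1_differentiable_on_def
  proof (intro exI[of _ ?d] conjI ballI)
    show "continuous_on {0<..} ?d"
      using pos by (intro continuous_intros cont) (auto simp: less_le)
  qed (use deriv in \<open>auto simp flip: has_real_derivative_iff_has_vector_derivative\<close>)
  have "solves_P3_inf k \<rho> c lam \<Theta> s3 (quadratic_profile \<Theta> A B s3)"
  proof (subst quadratic_profile_solves_iff[OF pos])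
    have "s3 t * ?d t = 6 * \<alpha> * B" if "t > 0" for t using pos that by (simp add: less_le)
    moreover have "k * A * \<Theta> = \<rho> * lam * (6 * \<alpha> * B)" using k\<Theta> SA by algebra
    ultimately show "A + B = 1 \<and> s3 0 = 0 \<and> (\<forall>t>0. s3 t * ?d t = 6 * (k / (\<rho> * c)) * B \<and>
        k * A * \<Theta> = \<rho> * lam * (s3 t * ?d t))"
      using AB assms(6) by (simp add: s3_sqrt)
  qed (use deriv assms(5) in auto)
  then have ex: "quadratic_solution_P3_inf k \<rho> c lam \<Theta> s3 (quadratic_profile \<Theta> A B s3)"
    unfolding quadratic_solution_P3_inf_def using A B pos cont C1 by blast
  have "(\<forall>t\<ge>0. s t = s3 t) \<and> (\<forall>t>0. \<forall>x\<in>{0..s3 t}. T x t = quadratic_profile \<Theta> A B s3 x t)"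
    if "quadratic_solution_P3_inf k \<rho> c lam \<Theta> s T" for s T
  proof -
    from that obtain A' B' where s_cont: "continuous_on {0..} s" and s_pos: "\<forall>t>0. 0 < s t"
      and prof: "\<forall>t>0. \<forall>x\<in>{0..s t}. T x t = quadratic_profile \<Theta> A' B' s x t"
      and sol: "solves_P3_inf k \<rho> c lam \<Theta> s T"
      unfolding quadratic_solution_P3_inf_def by blast
    from sol obtain s' where s': "\<forall>t>0. (s has_real_derivative s' t) (at t)"
      unfolding solves_P3_inf_def by blast
    have AB': "A' + B' = 1" and s0: "s 0 = 0"
      and ode: "\<And>t. t > 0 \<Longrightarrow> s t * s' t = 6 * \<alpha> * B'"
      and Stefan: "k * A' * \<Theta> = \<rho> * lam * (6 * \<alpha> * B')"
      \<comment> \<open>The relation \<open>Stefan\<close> contains no time; it comes from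
        evaluating both conditions at time 1.\<close>
      using sol[unfolded quadratic_profile_solves_iff[OF s_pos s' prof less_imp_neq[THEN not_sym, OF assms(5)]]]
        assms(6) zero_less_one[where 'a = real]
      by metis+
    have "(\<rho> * lam * \<alpha>) * (Ste * A') = (\<rho> * lam * \<alpha>) * (6 * B')"
      using Stefan k\<Theta> by algebra
    then have "Ste * A' = 6 * B'" using assms(2,4) \<alpha> by simp
    \<comment> \<open>Substituting \<open>B' = 1 - A'\<close> leaves one linear equation for
      \<open>A'\<close>.\<close>
    then have "A' * (6 + Ste) = 6" using AB' by algebra
    then have A': "A' = A" using eq_divide_imp[of "6 + Ste" A' 6] assms(8) Ste by simp
    then have B': "B' = B" using AB AB' by simp
    have s_eq: "s t = s3 t" if t: "t \<ge> 0" for t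
    proof -
      have "(s t)\<^sup>2 = 12 * \<alpha> * B * t"
        using square_front_linear[OF s_cont s0 _ ode t] s' B' by simp
      \<comment> \<open>The sign selects the root of the square; positivity covers only
        \<open>t > 0\<close>, so time 0 uses the initial condition.\<close>
      moreover have "s t \<ge> 0" using s_pos s0 t by (cases "t = 0") (auto intro: less_imp_le)
      ultimately show ?thesis
        unfolding s3_sqrt by (metis real_sqrt_unique)
    qed
    then show ?thesis using prof A' B' by (auto simp: quadratic_profile_def)
  qed
  with A B \<xi> ex show ?thesis by blast
qed

end
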